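(* Let $(A,D(A))$ be a closed, densely defined operator on a complex Banach space $X\neq\{0\}$. Then the following hold. (1) $A$ is bounded if and only if $\sigma_n(A)$ is compact. (2) $A=0$ if and only if $\sigma_n(A)=\{0\}$.
   Context: For $\theta\in[0,2\pi)$ and $\omega\in\mathbb{R}$ let $H_{\theta,\omega}:=\{e^{i\theta}\lambda:\ \lambda\in\mathbb{C},\ \mathrm{Re}\,\lambda>\omega\}$, an open half plane with boundary $\partial H_{\theta,\omega}$, and let $d(\lambda,\partial H_{\theta,\omega}):=\inf\{|\lambda-\mu|:\mu\in\partial H_{\theta,\omega}\}$. For a closed, densely defined operator $(A,D(A))$ with resolvent set $\rho(A)$ and resolvent $R(\lambda,A)=(\lambda-A)^{-1}$, the numerical resolvent set $\rho_n(A)$ is the union of all open half planes $H_{\theta,\omega}$ (with $\theta\in[0,2\pi)$, $\omega\in\mathbb{R}$) such that $H_{\theta,\omega}\subseteq\rho(A)$ and $\|R(\lambda,A)\|\le \frac{1}{d(\lambda,\partial H_{\theta,\omega})}$ for all $\lambda\in H_{\theta,\omega}$. The numerical spectrum is $\sigma_n(A):=\mathbb{C}\setminus\rho_n(A)$. *)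

theory Defs
  imports "HOL-Analysis.Analysis"
begin

class complex_normed_vector = real_normed_vector +
  fixes scaleC :: "complex \<Rightarrow> 'a \<Rightarrow> 'a"  (infixr \<open>*\<^sub>C\<close> 75)
  assumes scaleC_add_right: "c *\<^sub>C (x + y) = c *\<^sub>C x + c *\<^sub>C y"
    and scaleC_add_left: "(c + d) *\<^sub>C x = c *\<^sub>C x + d *\<^sub>C x"
    and scaleC_scaleC: "c *\<^sub>C (d *\<^sub>C x) = (c * d) *\<^sub>C x"
    and scaleC_one: "1 *\<^sub>C x = x"
    and scaleR_scaleC: "r *\<^sub>R x = complex_of_real r *\<^sub>C x"
    and norm_scaleC: "norm (c *\<^sub>C x) = cmod c * norm x"

lemma vector_space_scaleC:
  "vector_space (scaleC :: complex \<Rightarrow> 'a \<Rightarrow> 'a::complex_normed_vector)"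
  by unfold_locales (simp_all add: scaleC_add_right scaleC_add_left scaleC_scaleC scaleC_one)

class complex_banach = complex_normed_vector + complete_space

subclass (in complex_banach) banach ..

instantiation complex :: complex_banach
begin
definition scaleC_complex :: "complex \<Rightarrow> complex \<Rightarrow> complex" where
  "scaleC_complex c x = c * x"
instance
  by standard (simp_all add: scaleC_complex_def algebra_simps norm_mult scaleR_conv_of_real)
end

text \<open>
  An operator \<open>(A, D(A))\<close> is given by its domain \<open>D\<close> together with a function \<open>A\<close> on the whole
  type; the values of \<open>A\<close> outside \<open>D\<close> play no role in any definition below.
\<close>

definition linear_operator :: "'a::complex_normed_vector set \<Rightarrow> ('a \<Rightarrow> 'a) \<Rightarrow> bool" where
  "linear_operator D A \<longleftrightarrow>
     module.subspace scaleC D \<and>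
     (\<forall>x\<in>D. \<forall>y\<in>D. A (x + y) = A x + A y) \<and>
     (\<forall>c. \<forall>x\<in>D. A (c *\<^sub>C x) = c *\<^sub>C A x)"

definition closed_operator :: "'a::complex_normed_vector set \<Rightarrow> ('a \<Rightarrow> 'a) \<Rightarrow> bool" where
  "closed_operator D A \<longleftrightarrow> linear_operator D A \<and> closed ((\<lambda>x. (x, A x)) ` D)"

definition densely_defined :: "'a::complex_normed_vector set \<Rightarrow> bool" where
  "densely_defined D \<longleftrightarrow> closure D = UNIV"

definition bounded_operator :: "'a::complex_normed_vector set \<Rightarrow> ('a \<Rightarrow> 'a) \<Rightarrow> bool" where
  "bounded_operator D A \<longleftrightarrow> (\<exists>C. \<forall>x\<in>D. norm (A x) \<le> C * norm x)"

definition zero_operator :: "'a::complex_normed_vector set \<Rightarrow> ('a \<Rightarrow> 'a) \<Rightarrow> bool" where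
  "zero_operator D A \<longleftrightarrow> D = UNIV \<and> (\<forall>x. A x = 0)"

definition resolvent :: "'a::complex_normed_vector set \<Rightarrow> ('a \<Rightarrow> 'a) \<Rightarrow> complex \<Rightarrow> 'a \<Rightarrow> 'a" where
  "resolvent D A z = the_inv_into D (\<lambda>x. z *\<^sub>C x - A x)"

text \<open>
  Boundedness of the inverse is automatic for closed \<open>A\<close> on a Banach space (closed graph theorem);
  it is part of the definition so that the operator norm of the resolvent makes sense.
\<close>

definition resolvent_set :: "'a::complex_normed_vector set \<Rightarrow> ('a \<Rightarrow> 'a) \<Rightarrow> complex set" where
  "resolvent_set D A =
     {z. bij_betw (\<lambda>x. z *\<^sub>C x - A x) D UNIV \<and> bounded_linear (resolvent D A z)}"

definition half_plane :: "real \<Rightarrow> real \<Rightarrow> complex set" where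
  "half_plane \<theta> \<omega> = {exp (\<i> * complex_of_real \<theta>) * z | z. Re z > \<omega>}"

definition numerical_resolvent_set :: "'a::complex_normed_vector set \<Rightarrow> ('a \<Rightarrow> 'a) \<Rightarrow> complex set" where
  "numerical_resolvent_set D A =
     \<Union> {half_plane \<theta> \<omega> | \<theta> \<omega>.
          \<theta> \<in> {0..<2 * pi} \<and>
          half_plane \<theta> \<omega> \<subseteq> resolvent_set D A \<and>
          (\<forall>z\<in>half_plane \<theta> \<omega>.
             onorm (resolvent D A z) \<le> 1 / infdist z (frontier (half_plane \<theta> \<omega>)))}"

definition numerical_spectrum :: "'a::complex_normed_vector set \<Rightarrow> ('a \<Rightarrow> 'a) \<Rightarrow> complex set" where
  "numerical_spectrum D A = - numerical_resolvent_set D A"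

text \<open>
  For closed, densely defined operators, boundedness on \<open>D(A)\<close> already forces \<open>D(A) = X\<close>, so
  \<^const>\<open>bounded_operator\<close> then means that \<open>A\<close> is a bounded operator on all of \<open>X\<close>.
\<close>

lemma bounded_operator_domain:
  fixes A :: "'a::complex_banach \<Rightarrow> 'a"
  assumes cl: "closed_operator D A" and dense: "densely_defined D" and bd: "bounded_operator D A"
  shows "D = UNIV"
proof -
  interpret cv: vector_space "scaleC :: complex \<Rightarrow> 'a \<Rightarrow> 'a"
    by (rule vector_space_scaleC)
  have sub: "cv.subspace D" and add: "\<And>x y. x \<in> D \<Longrightarrow> y \<in> D \<Longrightarrow> A (x + y) = A x + A y"
    and clG: "closed ((\<lambda>x. (x, A x)) ` D)"
    using cl by (auto simp: closed_operator_def linear_operator_def)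
  obtain C where C: "\<And>x. x \<in> D \<Longrightarrow> norm (A x) \<le> C * norm x"
    using bd by (auto simp: bounded_operator_def)
  have diff: "A (x - y) = A x - A y" if "x \<in> D" "y \<in> D" for x y
    using add[of "x - y" y] that cv.subspace_diff[OF sub] by auto
  have "x \<in> D" for x
  proof -
    obtain u where u: "\<And>n. u n \<in> D" "u \<longlonglongrightarrow> x"
      using dense unfolding densely_defined_def by (metis UNIV_I closure_sequential)
    have C': "norm (A y) \<le> (\<bar>C\<bar> + 1) * norm y" if "y \<in> D" for y
      by (rule order_trans[OF C[OF that]]) (intro mult_right_mono, auto)
    have "Cauchy (\<lambda>n. A (u n))"
    proof (rule metric_CauchyI)
      fix e :: real assume "e > 0"
      then have "e / (\<bar>C\<bar> + 1) > 0" by simp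
      then obtain M where M: "\<And>m n. m \<ge> M \<Longrightarrow> n \<ge> M \<Longrightarrow> dist (u m) (u n) < e / (\<bar>C\<bar> + 1)"
        using metric_CauchyD[OF LIMSEQ_imp_Cauchy[OF u(2)]] by blast
      have "dist (A (u m)) (A (u n)) < e" if "m \<ge> M" "n \<ge> M" for m n
      proof -
        have "dist (A (u m)) (A (u n)) \<le> (\<bar>C\<bar> + 1) * dist (u m) (u n)"
          using C'[OF cv.subspace_diff[OF sub u(1) u(1)], of m n] by (simp add: dist_norm diff u(1))
        also have "\<dots> < e"
          using M[OF that] by (simp add: field_simps)
        finally show ?thesis .
      qed
      then show "\<exists>M. \<forall>m\<ge>M. \<forall>n\<ge>M. dist (A (u m)) (A (u n)) < e" by blast
    qed
    then obtain y where "(\<lambda>n. A (u n)) \<longlonglongrightarrow> y"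
      using Cauchy_convergent convergent_def by blast
    then have "(\<lambda>n. (u n, A (u n))) \<longlonglongrightarrow> (x, y)"
      using u(2) by (intro tendsto_Pair)
    then have "(x, y) \<in> (\<lambda>x. (x, A x)) ` D"
      by (rule closed_sequentially[OF clG, rotated]) (use u(1) in auto)
    then show ?thesis by auto
  qed
  then show ?thesis by auto
qed

end

theory Submission
  imports Defs "HOL-Real_Asymp.Real_Asymp"
begin

text \<open>
  Call a half plane admissible if it is one of those whose union is the numerical resolvent set.

  If \<open>\<parallel>A x\<parallel> \<le> C \<parallel>x\<parallel>\<close> on the whole space, the Neumann series gives \<open>\<parallel>R(z)\<parallel> \<le> 1 / (\<bar>z\<bar> - C)\<close> for
  \<open>\<bar>z\<bar> > C\<close>, and since \<open>\<bar>z\<bar>\<close> dominates the component of \<open>z\<close> in any direction, all half planes with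
  \<open>\<omega> = C\<close> are admissible. Hence the numerical spectrum lies in the disc of
  radius \<open>C\<close> (\<open>numerical_spectrum_bound\<close>). Being closed, it is compact; for \<open>C = 0\<close> it is contained
  in \<open>{0}\<close>, and \<open>0\<close> belongs to it because the zero map on a nonzero space is not injective.

  Conversely let the numerical spectrum lie in the closed disc of radius \<open>r\<close>. Both remaining
  implications follow from the single estimate \<open>\<parallel>A x\<parallel> \<le> s\<^sup>2 / (s - r) \<parallel>x\<parallel>\<close>, valid for every \<open>s > r\<close>
  (\<open>operator_norm_le_of_numerical_spectrum\<close>): it makes \<open>A\<close> bounded, and for \<open>r = 0\<close> it reads
  \<open>\<parallel>A x\<parallel> \<le> s \<parallel>x\<parallel>\<close> for all \<open>s > 0\<close>, so that \<open>A = 0\<close>. The estimate has two ingredients.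

  First, the numerical spectrum contains enough of the numerical range. For \<open>x\<close> in the domain of
  \<open>A\<^sup>2\<close>, the convex function \<open>w \<mapsto> \<parallel>x + w A x\<parallel>\<close> on the complex plane has a subgradient at \<open>0\<close>. It
  provides a number \<open>\<mu> = \<phi> (A x) / \<parallel>x\<parallel>\<close>, where \<open>\<phi>\<close> is a functional of norm one with \<open>\<phi> x = \<parallel>x\<parallel>\<close> on
  the span of \<open>x\<close> and \<open>A x\<close>; a subgradient in the plane thus replaces the Hahn-Banach theorem.
  As in the Lumer-Phillips theorem, an admissible half plane cannot contain
  \<open>\<mu>\<close> (\<open>subgradient_in_numerical_spectrum\<close>), so \<open>\<bar>\<mu>\<bar> \<le> r\<close>. Then the subgradient inequality says
  \<open>\<parallel>(z - A) x\<parallel> \<ge> (\<bar>z\<bar> - r) \<parallel>x\<parallel>\<close>, and by density \<open>\<parallel>R(z)\<parallel> \<le> 1 / (\<bar>z\<bar> - r)\<close> for all \<open>\<bar>z\<bar> > r\<close>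
  (\<open>resolvent_bound\<close>).

  Second, a resolvent defined near infinity with \<open>\<parallel>z R(z)\<parallel> \<le> M\<close> for \<open>\<bar>z\<bar> \<ge> s\<close> forces
  \<open>\<parallel>A x\<parallel> \<le> s M \<parallel>x\<parallel>\<close> (\<open>operator_norm_le\<close>). This is Cauchy's formula \<open>A x = 1/(2\<pi>\<i>) \<integral> z R(z) x dz\<close> over
  the circle \<open>\<bar>z\<bar> = s\<close>. Instead of integrals, means over the vertices of a regular \<open>n\<close>-gon are used,
  and contour independence becomes the estimate \<open>circle_mean_step\<close>: the mean changes only by
  \<open>O(1 / n\<^sup>2)\<close> when the polygon is multiplied by a suitable number, whose modulus is at least
  \<open>exp (\<pi> / n)\<close> for large \<open>n\<close>. Thus \<open>n j\<close> enlargements push the polygon out by a factor of at least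
  \<open>exp (\<pi> j)\<close> at a total cost of \<open>O(j / n)\<close>.
\<close>

section \<open>Half planes and the numerical resolvent set\<close>

interpretation scaleC: vector_space "scaleC :: complex \<Rightarrow> 'a \<Rightarrow> 'a::complex_normed_vector"
  by (rule vector_space_scaleC)

lemma infdist_hyperplane:
  fixes a z :: "'a::euclidean_space"
  assumes "norm a = 1"
  shows "infdist z {x. a \<bullet> x = b} = \<bar>a \<bullet> z - b\<bar>"
proof (rule antisym)
  have aa: "a \<bullet> a = 1"
    using assms by (simp add: dot_square_norm)
  define p where "p = z - (a \<bullet> z - b) *\<^sub>R a"
  have p: "p \<in> {x. a \<bullet> x = b}"
    by (simp add: p_def inner_diff_right aa)
  have "dist z p = \<bar>a \<bullet> z - b\<bar>"
    by (simp add: p_def dist_norm assms)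
  then show "infdist z {x. a \<bullet> x = b} \<le> \<bar>a \<bullet> z - b\<bar>"
    using infdist_le[OF p, of z] by simp
  have "\<bar>a \<bullet> z - b\<bar> \<le> dist z x" if "a \<bullet> x = b" for x
    using Cauchy_Schwarz_ineq2[of a "z - x"] that assms by (simp add: inner_diff_right dist_norm)
  then show "\<bar>a \<bullet> z - b\<bar> \<le> infdist z {x. a \<bullet> x = b}"
    using p by (auto simp: infdist_def intro!: cINF_greatest)
qed

lemma half_plane_eq: "half_plane \<theta> \<omega> = {z. cis \<theta> \<bullet> z > \<omega>}"
proof (intro set_eqI iffI)
  fix z assume "z \<in> half_plane \<theta> \<omega>"
  then obtain y where "z = cis \<theta> * y" "Re y > \<omega>"
    by (auto simp: half_plane_def cis_conv_exp)
  moreover have "cis \<theta> \<bullet> (cis \<theta> * y) = Re y * ((cos \<theta>)\<^sup>2 + (sin \<theta>)\<^sup>2)"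
    unfolding inner_complex_def by (simp del: sin_cos_squared_add2) algebra
  ultimately show "z \<in> {z. cis \<theta> \<bullet> z > \<omega>}" by simp
next
  fix z assume "z \<in> {z. cis \<theta> \<bullet> z > \<omega>}"
  then have "Re (cis (- \<theta>) * z) > \<omega>" by (simp add: inner_complex_def)
  moreover have "z = exp (\<i> * complex_of_real \<theta>) * (cis (- \<theta>) * z)"
    by (simp add: cis_conv_exp flip: exp_add mult.assoc)
  ultimately show "z \<in> half_plane \<theta> \<omega>" unfolding half_plane_def by blast
qed

lemma open_half_plane: "open (half_plane \<theta> \<omega>)"
  unfolding half_plane_eq by (rule open_halfspace_gt)

lemma infdist_frontier_half_plane:
  assumes "z \<in> half_plane \<theta> \<omega>"
  shows "infdist z (frontier (half_plane \<theta> \<omega>)) = cis \<theta> \<bullet> z - \<omega>"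
proof -
  have "frontier (half_plane \<theta> \<omega>) = {z. cis \<theta> \<bullet> z = \<omega>}"
    unfolding half_plane_eq by (rule frontier_halfspace_gt) simp
  then show ?thesis
    using assms by (simp add: infdist_hyperplane half_plane_eq)
qed

text \<open>
  In terms of the component \<open>cis \<theta> \<bullet> z\<close>, the distance to the boundary becomes
  \<open>cis \<theta> \<bullet> z - \<omega>\<close>, and the resolvent bound is that of a generator \<open>cis (- \<theta>) A\<close> of an
  \<open>\<omega>\<close>-contractive semigroup.
\<close>

lemma numerical_resolvent_set_iff:
  "\<mu> \<in> numerical_resolvent_set D A \<longleftrightarrow>
     (\<exists>\<theta>\<in>{0..<2 * pi}. \<exists>\<omega>. cis \<theta> \<bullet> \<mu> > \<omega> \<and>
        (\<forall>z. cis \<theta> \<bullet> z > \<omega> \<longrightarrow>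
           z \<in> resolvent_set D A \<and> onorm (resolvent D A z) \<le> 1 / (cis \<theta> \<bullet> z - \<omega>)))"
proof -
  have "(half_plane \<theta> \<omega> \<subseteq> resolvent_set D A \<and>
          (\<forall>z\<in>half_plane \<theta> \<omega>.
             onorm (resolvent D A z) \<le> 1 / infdist z (frontier (half_plane \<theta> \<omega>)))) \<longleftrightarrow>
        (\<forall>z. cis \<theta> \<bullet> z > \<omega> \<longrightarrow>
           z \<in> resolvent_set D A \<and> onorm (resolvent D A z) \<le> 1 / (cis \<theta> \<bullet> z - \<omega>))" for \<theta> \<omega>
    using infdist_frontier_half_plane[of _ \<theta> \<omega>]
    by (auto simp: half_plane_eq)
  moreover have "\<mu> \<in> half_plane \<theta> \<omega> \<longleftrightarrow> cis \<theta> \<bullet> \<mu> > \<omega>" for \<theta> \<omega>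
    by (simp add: half_plane_eq)
  ultimately show ?thesis
    unfolding numerical_resolvent_set_def by blast
qed

lemma closed_numerical_spectrum: "closed (numerical_spectrum D A)"
  unfolding numerical_spectrum_def numerical_resolvent_set_def
  by (auto intro!: open_Union open_half_plane)

lemma spectrum_subset_numerical_spectrum:
  "z \<notin> numerical_spectrum D A \<Longrightarrow> z \<in> resolvent_set D A"
  by (auto simp: numerical_spectrum_def numerical_resolvent_set_iff)

lemma linear_operator_diff:
  assumes "linear_operator D A" "x \<in> D" "y \<in> D"
  shows "A (x - y) = A x - A y"
proof -
  have "x - y \<in> D"
    using assms scaleC.subspace_diff unfolding linear_operator_def by blast
  then have "A ((x - y) + y) = A (x - y) + A y"
    using assms unfolding linear_operator_def by blast
  then show ?thesis by simp
qed

section \<open>Resolvents\<close>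

context
  fixes D :: "'a::complex_normed_vector set" and A :: "'a \<Rightarrow> 'a"
  assumes lin: "linear_operator D A"
begin

lemma subspace_domain: "scaleC.subspace D"
  using lin by (simp add: linear_operator_def)

lemma operator_scaleC: "x \<in> D \<Longrightarrow> A (c *\<^sub>C x) = c *\<^sub>C A x"
  using lin by (simp add: linear_operator_def)

lemma resolvent_in_domain:
  assumes "z \<in> resolvent_set D A"
  shows "resolvent D A z y \<in> D"
  using assms unfolding resolvent_set_def resolvent_def bij_betw_def
  by (auto intro: the_inv_into_into)

lemma resolvent_right_inverse:
  assumes "z \<in> resolvent_set D A"
  shows "z *\<^sub>C resolvent D A z y - A (resolvent D A z y) = y"
  using assms f_the_inv_into_f_bij_betw[of "\<lambda>x. z *\<^sub>C x - A x" D UNIV y]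
  unfolding resolvent_set_def resolvent_def by simp

lemma resolvent_left_inverse:
  assumes "z \<in> resolvent_set D A" "x \<in> D"
  shows "resolvent D A z (z *\<^sub>C x - A x) = x"
  using assms the_inv_into_f_f[of "\<lambda>x. z *\<^sub>C x - A x" D x]
  unfolding resolvent_set_def resolvent_def bij_betw_def by simp

lemma bounded_linear_resolvent:
  "z \<in> resolvent_set D A \<Longrightarrow> bounded_linear (resolvent D A z)"
  by (simp add: resolvent_set_def)

lemma resolvent_diff:
  assumes "z \<in> resolvent_set D A"
  shows "resolvent D A z (x - y) = resolvent D A z x - resolvent D A z y"
  using bounded_linear_resolvent[OF assms] by (simp add: bounded_linear.linear linear_diff)

lemma resolvent_scaleC:
  assumes z: "z \<in> resolvent_set D A"
  shows "resolvent D A z (c *\<^sub>C y) = c *\<^sub>C resolvent D A z y"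
proof -
  let ?x = "resolvent D A z y"
  have x: "?x \<in> D" by (rule resolvent_in_domain[OF z])
  then have cx: "c *\<^sub>C ?x \<in> D"
    using scaleC.subspace_scale[OF subspace_domain] by blast
  have "z *\<^sub>C c *\<^sub>C ?x - A (c *\<^sub>C ?x) = c *\<^sub>C (z *\<^sub>C ?x - A ?x)"
    by (simp add: operator_scaleC[OF x] scaleC.scale_right_diff_distrib mult.commute)
  then show ?thesis
    using resolvent_left_inverse[OF z cx] by (simp add: resolvent_right_inverse[OF z])
qed

lemma resolvent_apply_operator:
  assumes "z \<in> resolvent_set D A" "x \<in> D"
  shows "resolvent D A z (A x) = z *\<^sub>C resolvent D A z x - x"
  using resolvent_left_inverse[OF assms]
  by (simp add: resolvent_diff resolvent_scaleC assms algebra_simps)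

lemma resolvent_identity:
  assumes z: "z \<in> resolvent_set D A" and z': "z' \<in> resolvent_set D A"
  shows "resolvent D A z' y - resolvent D A z y
           = (z - z') *\<^sub>C resolvent D A z (resolvent D A z' y)"
proof -
  let ?u = "resolvent D A z' y"
  have "z *\<^sub>C ?u - A ?u = y - (z' - z) *\<^sub>C ?u"
    using resolvent_right_inverse[OF z', of y] by (simp add: scaleC.scale_left_diff_distrib algebra_simps)
  with resolvent_left_inverse[OF z resolvent_in_domain[OF z']]
  have "?u = resolvent D A z (y - (z' - z) *\<^sub>C ?u)"
    by metis
  also have "\<dots> = resolvent D A z y - (z' - z) *\<^sub>C resolvent D A z ?u"
    by (simp add: resolvent_diff resolvent_scaleC z)
  finally show ?thesis
    by (simp add: scaleC.scale_left_diff_distrib algebra_simps)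
qed

end

section \<open>Bounded operators have bounded numerical spectrum\<close>

text \<open>
  The equation \<open>z x - A x = y\<close> is the fixed point equation of \<open>x \<mapsto> (y + A x) / z\<close>, a contraction with
  factor \<open>C / \<bar>z\<bar>\<close>.
\<close>

lemma resolvent_of_bounded:
  fixes A :: "'a::complex_banach \<Rightarrow> 'a"
  assumes lin: "linear_operator UNIV A" and C: "\<And>x. norm (A x) \<le> C * norm x"
    and z: "cmod z > C" and C0: "C \<ge> 0"
  shows "z \<in> resolvent_set UNIV A" "onorm (resolvent UNIV A z) \<le> 1 / (cmod z - C)"
proof -
  let ?f = "\<lambda>x. z *\<^sub>C x - A x"
  have z0: "z \<noteq> 0" using z C0 by auto
  have diff: "A (x - y) = A x - A y" for x y
    by (rule linear_operator_diff[OF lin]) auto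
  have "\<exists>!x. ?f x = y" for y
  proof -
    have "\<exists>!x. (x \<in> UNIV \<and> (\<lambda>x. inverse z *\<^sub>C (y + A x)) x = x)"
    proof (rule Banach_fix)
      show "0 \<le> C / cmod z" "C / cmod z < 1" using z C0 z0 by auto
      fix x x' assume "x \<in> (UNIV::'a set)" "x' \<in> (UNIV::'a set)"
      have "inverse z *\<^sub>C (y + A x) - inverse z *\<^sub>C (y + A x') = inverse z *\<^sub>C A (x - x')"
        by (simp add: diff flip: scaleC.scale_right_diff_distrib)
      then have "dist (inverse z *\<^sub>C (y + A x)) (inverse z *\<^sub>C (y + A x')) = norm (A (x - x')) / cmod z"
        by (simp add: dist_norm norm_scaleC norm_inverse divide_inverse mult.commute)
      also have "\<dots> \<le> C / cmod z * dist x x'"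
        using divide_right_mono[OF C[of "x - x'"], of "cmod z"] by (simp add: dist_norm)
      finally show "dist (inverse z *\<^sub>C (y + A x)) (inverse z *\<^sub>C (y + A x')) \<le> C / cmod z * dist x x'" .
    qed (auto simp: complete_UNIV)
    moreover have "inverse z *\<^sub>C (y + A x) = x \<longleftrightarrow> ?f x = y" for x
    proof -
      have "inverse z *\<^sub>C (y + A x) = x \<longleftrightarrow> z *\<^sub>C inverse z *\<^sub>C (y + A x) = z *\<^sub>C x"
        using z0 by (subst scaleC.scale_cancel_left) auto
      then show ?thesis using z0 by (auto simp: algebra_simps)
    qed
    ultimately show ?thesis by simp
  qed
  then have bij: "bij_betw ?f UNIV UNIV"
    unfolding bij_iff by blast
  let ?R = "resolvent UNIV A z"
  have R: "?f (?R y) = y" for y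
    unfolding resolvent_def using f_the_inv_into_f_bij_betw[OF bij] by simp
  have R': "?R (?f x) = x" for x
    unfolding resolvent_def using the_inv_into_f_f[of ?f UNIV x] bij by (simp add: bij_betw_def)
  have bound: "norm (?R y) \<le> 1 / (cmod z - C) * norm y" for y
  proof -
    have "norm (z *\<^sub>C ?R y) - norm (A (?R y)) \<le> norm y"
      using norm_triangle_ineq2[of "z *\<^sub>C ?R y" "A (?R y)"] R by simp
    then have "(cmod z - C) * norm (?R y) \<le> norm y"
      using C[of "?R y"] by (simp add: norm_scaleC algebra_simps)
    then show ?thesis using z by (simp add: field_simps)
  qed
  have "bounded_linear ?R"
  proof (rule bounded_linear_intro)
    show "norm (?R y) \<le> norm y * (1 / (cmod z - C))" for y
      using bound[of y] by (simp add: mult.commute)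
    have add: "?f (x + y) = ?f x + ?f y" for x y
      using lin by (simp add: linear_operator_def scaleC.scale_right_distrib)
    show "?R (x + y) = ?R x + ?R y" for x y
      using R'[of "?R x + ?R y"] by (simp only: add R)
    have scale: "?f (t *\<^sub>R x) = t *\<^sub>R ?f x" for t x
      using lin by (simp add: linear_operator_def scaleR_scaleC scaleC.scale_right_diff_distrib
          mult.commute)
    show "?R (t *\<^sub>R x) = t *\<^sub>R ?R x" for t x
      using R'[of "t *\<^sub>R ?R x"] by (simp only: scale R)
  qed
  then show "z \<in> resolvent_set UNIV A"
    using bij by (simp add: resolvent_set_def)
  show "onorm ?R \<le> 1 / (cmod z - C)"
    using bound z by (intro onorm_bound) auto
qed

text \<open>
  A point \<open>\<mu>\<close> outside the disc is covered by the half plane whose inward normal is the direction of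
  \<open>\<mu>\<close> itself and whose boundary is tangent to the disc.
\<close>

lemma numerical_spectrum_bound:
  fixes A :: "'a::complex_banach \<Rightarrow> 'a"
  assumes lin: "linear_operator UNIV A" and C: "\<And>x. norm (A x) \<le> C * norm x" and C0: "C \<ge> 0"
  shows "numerical_spectrum UNIV A \<subseteq> cball 0 C"
proof (rule ccontr)
  assume "\<not> ?thesis"
  then obtain \<mu> where \<mu>: "\<mu> \<notin> numerical_resolvent_set UNIV A" "cmod \<mu> > C"
    by (force simp: numerical_spectrum_def)
  let ?c = "cis (Arg2pi \<mu>)"
  have "?c \<bullet> \<mu> = cmod \<mu>"
  proof -
    have "\<mu> = cmod \<mu> *\<^sub>R ?c"
      by (metis Arg2pi_eq cis_conv_exp scaleR_conv_of_real)
    then have "?c \<bullet> \<mu> = cmod \<mu> * (?c \<bullet> ?c)" by (metis inner_scaleR_right)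
    then show ?thesis by (simp add: dot_square_norm)
  qed
  moreover have "z \<in> resolvent_set UNIV A \<and> onorm (resolvent UNIV A z) \<le> 1 / (?c \<bullet> z - C)"
    if "?c \<bullet> z > C" for z
  proof -
    have le: "?c \<bullet> z \<le> cmod z" using norm_cauchy_schwarz[of ?c z] by simp
    with that have z: "cmod z > C" by simp
    have "1 / (cmod z - C) \<le> 1 / (?c \<bullet> z - C)"
      using that le by (intro divide_left_mono) auto
    then show ?thesis using resolvent_of_bounded[OF lin C z C0] by auto
  qed
  ultimately have "\<mu> \<in> numerical_resolvent_set UNIV A"
    unfolding numerical_resolvent_set_iff using \<mu>(2) Arg2pi_ge_0[of \<mu>] Arg2pi_lt_2pi[of \<mu>]
    by (intro bexI[of _ "Arg2pi \<mu>"] exI[of _ C]) auto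
  with \<mu> show False by blast
qed

section \<open>The numerical range lies in the numerical spectrum\<close>

text \<open>
  Separate the point \<open>(x, f x)\<close> from the strict epigraph of \<open>f\<close>. Since \<open>f\<close> is finite everywhere, the
  separating hyperplane is not vertical, and its slope is a subgradient.
\<close>

lemma convex_subgradient_exists:
  fixes f :: "'a::euclidean_space \<Rightarrow> real"
  assumes "convex_on UNIV f"
  shows "\<exists>g. \<forall>y. f y \<ge> f x + g \<bullet> (y - x)"
proof -
  let ?E = "{p. f (fst p) < snd p}"
  have "convex ?E"
  proof (rule convexI)
    fix p q :: "'a \<times> real" and u v :: real
    assume pq: "p \<in> ?E" "q \<in> ?E" and uv: "0 \<le> u" "0 \<le> v" "u + v = 1"
    have "f (u *\<^sub>R fst p + v *\<^sub>R fst q) \<le> u * f (fst p) + v * f (fst q)"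
      using assms uv by (simp add: convex_on_def)
    also have "\<dots> < u * snd p + v * snd q"
    proof (cases "u = 0")
      case False
      then have "u * f (fst p) < u * snd p" using pq uv by simp
      moreover have "v * f (fst q) \<le> v * snd q" using pq uv by (simp add: mult_left_mono)
      ultimately show ?thesis by simp
    qed (use pq uv in auto)
    finally show "u *\<^sub>R p + v *\<^sub>R q \<in> ?E" by simp
  qed
  moreover have "?E \<noteq> {}" "{(x, f x)} \<inter> ?E = {}"
    by (auto intro!: exI[of _ x] exI[of _ "f x + 1"])
  ultimately obtain a b where ab: "a \<noteq> 0" "a \<bullet> (x, f x) \<le> b" "\<forall>p\<in>?E. a \<bullet> p \<ge> b"
    using separating_hyperplane_sets[of "{(x, f x)}" ?E] by auto
  obtain a1 a2 where a: "a = (a1, a2)" by (cases a)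
  have sep: "a1 \<bullet> x + a2 * f x \<le> a1 \<bullet> y + a2 * t" if "f y < t" for y t
    using ab(2) bspec[OF ab(3), of "(y, t)"] that by (simp add: a inner_Pair)
  have "a2 \<ge> 0" using sep[of x "f x + 1"] by (simp add: algebra_simps)
  moreover have "a2 \<noteq> 0"
  proof
    assume a2: "a2 = 0"
    have "a1 \<bullet> x \<le> a1 \<bullet> (x - a1)" using sep[of "x - a1" "f (x - a1) + 1"] by (simp add: a2)
    then have "a1 = 0" using inner_ge_zero[of a1] by (simp add: inner_diff_right)
    with a2 ab(1) a show False by (simp add: zero_prod_def)
  qed
  ultimately have pos: "a2 > 0" by simp
  have "f y \<ge> f x + ((- 1 / a2) *\<^sub>R a1) \<bullet> (y - x)" for y
  proof (rule field_le_epsilon)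
    fix e :: real assume "e > 0"
    then show "f x + ((- 1 / a2) *\<^sub>R a1) \<bullet> (y - x) \<le> f y + e"
      using sep[of y "f y + e"] pos by (simp add: inner_diff_right field_simps)
  qed
  then show ?thesis by blast
qed

text \<open>
  For \<open>z = s cis \<theta>\<close> in an admissible half plane, \<open>z x + A x = z\<^sup>2 R(z) x - R(z) A\<^sup>2 x\<close> has norm at most
  \<open>(s\<^sup>2 \<parallel>x\<parallel> + \<parallel>A\<^sup>2 x\<parallel>) / (s - \<omega>)\<close>, which is \<open>(s + \<omega>) \<parallel>x\<parallel>\<close> up to an error tending to \<open>0\<close> as
  \<open>s \<rightarrow> \<infinity>\<close>. The subgradient inequality at \<open>w = 1 / z\<close> bounds the same norm below by
  \<open>(s + p) \<parallel>x\<parallel>\<close>, where \<open>p\<close> is the component of \<open>\<mu>\<close> in the direction \<open>\<theta>\<close>. Hence \<open>p \<le> \<omega>\<close>, and the half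
  plane does not contain \<open>\<mu>\<close>. The expansion needs \<open>A x\<close> in the domain.
\<close>

lemma subgradient_in_numerical_spectrum:
  fixes A :: "'a::complex_normed_vector \<Rightarrow> 'a"
  assumes lin: "linear_operator D A" and x: "x \<in> D" "A x \<in> D" "x \<noteq> 0"
    and sub: "\<And>w. norm (x + w *\<^sub>C A x) \<ge> norm x * (1 + Re (w * \<mu>))"
  shows "\<mu> \<in> numerical_spectrum D A"
proof (rule ccontr)
  assume "\<mu> \<notin> numerical_spectrum D A"
  then obtain \<theta> \<omega> where \<mu>: "cis \<theta> \<bullet> \<mu> > \<omega>"
    and H: "\<And>z. cis \<theta> \<bullet> z > \<omega> \<Longrightarrow> z \<in> resolvent_set D A"
      "\<And>z. cis \<theta> \<bullet> z > \<omega> \<Longrightarrow> onorm (resolvent D A z) \<le> 1 / (cis \<theta> \<bullet> z - \<omega>)"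
    by (auto simp: numerical_spectrum_def numerical_resolvent_set_iff)
  define p where "p = cis \<theta> \<bullet> \<mu>"
  have est: "s * (p - \<omega>) * norm x \<le> p * \<omega> * norm x + norm (A (A x))" if s: "s > \<omega>" "s > 0" for s
  proof -
    define z where "z = s *\<^sub>R cis \<theta>"
    let ?R = "resolvent D A z"
    have cz: "cis \<theta> \<bullet> z = s" by (simp add: z_def dot_square_norm)
    have z: "z \<in> resolvent_set D A" and on: "onorm ?R \<le> 1 / (s - \<omega>)"
      using H[of z] s cz by auto
    have nz: "cmod z = s" using s by (simp add: z_def)
    have R: "norm (?R y) \<le> norm y / (s - \<omega>)" for y
      using order_trans[OF onorm[OF bounded_linear_resolvent[OF lin z], of y] mult_right_mono[OF on]]
      by simp
    have "z *\<^sub>C x + A x = (z * z) *\<^sub>C ?R x - ?R (A (A x))"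
      by (simp add: resolvent_apply_operator[OF lin z] x scaleC.scale_right_diff_distrib algebra_simps)
    then have "norm (z *\<^sub>C x + A x) \<le> s * s * norm (?R x) + norm (?R (A (A x)))"
      using norm_triangle_ineq4[of "(z * z) *\<^sub>C ?R x" "?R (A (A x))"] by (simp add: norm_scaleC norm_mult nz)
    also have "\<dots> \<le> s * s * (norm x / (s - \<omega>)) + norm (A (A x)) / (s - \<omega>)"
      using R s by (intro add_mono mult_left_mono) auto
    also have "\<dots> = (s * s * norm x + norm (A (A x))) / (s - \<omega>)"
      by (simp add: add_divide_distrib)
    finally have upper: "norm (z *\<^sub>C x + A x) * (s - \<omega>) \<le> s * s * norm x + norm (A (A x))"
      using s by (simp add: pos_le_divide_eq)
    have z0: "z \<noteq> 0" using nz s by auto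
    have "Re (inverse z * \<mu>) = p / s"
    proof -
      have "inverse z * \<mu> = (1 / s) *\<^sub>R (cis (- \<theta>) * \<mu>)"
        by (simp add: z_def scaleR_conv_of_real divide_inverse flip: cis_inverse)
      then show ?thesis by (simp add: p_def inner_complex_def)
    qed
    then have "norm x * (1 + p / s) \<le> norm (x + inverse z *\<^sub>C A x)"
      using sub[of "inverse z"] by simp
    then have "s * (norm x * (1 + p / s)) \<le> s * norm (x + inverse z *\<^sub>C A x)"
      using s by (intro mult_left_mono) auto
    also have "s * (norm x * (1 + p / s)) = norm x * (s + p)"
      using s by (simp add: field_simps)
    also have "s * norm (x + inverse z *\<^sub>C A x) = norm (z *\<^sub>C (x + inverse z *\<^sub>C A x))" by (simp add: norm_scaleC nz)
    also have "z *\<^sub>C (x + inverse z *\<^sub>C A x) = z *\<^sub>C x + A x"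
      using z0 by (simp add: scaleC.scale_right_distrib)
    finally have "norm x * (s + p) * (s - \<omega>) \<le> norm (z *\<^sub>C x + A x) * (s - \<omega>)"
      using s by (intro mult_right_mono) auto
    with upper show ?thesis by (simp add: algebra_simps)
  qed
  \<comment> \<open>The estimate \<open>s P \<le> B\<close> for all large \<open>s\<close> is impossible when \<open>P > 0\<close>.\<close>
  define P where "P = (p - \<omega>) * norm x"
  define B where "B = p * \<omega> * norm x + norm (A (A x))"
  define s where "s = \<bar>\<omega>\<bar> + 1 + \<bar>B\<bar> / P"
  have P: "P > 0" using \<mu> x by (simp add: P_def p_def)
  then have "\<bar>B\<bar> / P \<ge> 0" by simp
  then have "s > \<omega>" "s > 0" by (auto simp: s_def)
  then have "s * P \<le> B" using est[of s] by (simp add: P_def B_def mult.assoc)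
  moreover have "s * P = (\<bar>\<omega>\<bar> + 1) * P + \<bar>B\<bar>" using P by (simp add: s_def distrib_right)
  moreover have "(\<bar>\<omega>\<bar> + 1) * P > 0" using P by (intro mult_pos_pos) auto
  ultimately show False by linarith
qed

text \<open>
  The subgradient \<open>\<mu>\<close> of \<open>w \<mapsto> \<parallel>x + w A x\<parallel>\<close> at \<open>0\<close> has modulus at most \<open>r\<close>, and
  \<open>z x - A x = z (x + w A x)\<close> for \<open>w = - 1 / z\<close>; at this \<open>w\<close> the subgradient inequality gives the
  factor \<open>\<bar>z\<bar> (1 - r / \<bar>z\<bar>)\<close>.
\<close>

lemma norm_shifted_operator_lower_bound:
  fixes A :: "'a::complex_normed_vector \<Rightarrow> 'a"
  assumes lin: "linear_operator D A" and x: "x \<in> D" "A x \<in> D"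
    and r: "numerical_spectrum D A \<subseteq> cball 0 r" "r \<ge> 0" and z: "cmod z > r"
  shows "(cmod z - r) * norm x \<le> norm (z *\<^sub>C x - A x)"
proof (cases "x = 0")
  case False
  have z0: "z \<noteq> 0" using z r by auto
  let ?N = "\<lambda>w. norm (x + w *\<^sub>C A x)"
  have "convex_on UNIV ?N"
  proof (rule convex_onI)
    fix t :: real and w w' :: complex assume t: "0 < t" "t < 1"
    have "x + ((1 - t) *\<^sub>R w + t *\<^sub>R w') *\<^sub>C A x
        = (1 - t) *\<^sub>R (x + w *\<^sub>C A x) + t *\<^sub>R (x + w' *\<^sub>C A x)"
      by (simp add: scaleR_scaleC[where 'a = 'a] scaleR_conv_of_real algebra_simps)
    then show "?N ((1 - t) *\<^sub>R w + t *\<^sub>R w') \<le> (1 - t) * ?N w + t * ?N w'"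
      using norm_triangle_ineq[of "(1 - t) *\<^sub>R (x + w *\<^sub>C A x)" "t *\<^sub>R (x + w' *\<^sub>C A x)"] t
      by simp
  qed simp
  then obtain g where g: "\<And>w. ?N w \<ge> norm x + g \<bullet> w"
    using convex_subgradient_exists[of ?N 0] by auto
  \<comment> \<open>The real inner product \<open>g \<bullet> w\<close> on the plane is the real part of \<open>w\<close> times the conjugate of \<open>g\<close>.\<close>
  define \<mu> where "\<mu> = cnj g / norm x"
  have "norm x * Re (w * \<mu>) = g \<bullet> w" for w
    using False by (simp add: \<mu>_def inner_complex_def field_simps)
  then have sub: "?N w \<ge> norm x * (1 + Re (w * \<mu>))" for w
    unfolding distrib_left using g[of w] by simp
  have "\<mu> \<in> numerical_spectrum D A"
    by (rule subgradient_in_numerical_spectrum[OF lin x False sub])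
  then have \<mu>: "cmod \<mu> \<le> r" using r by auto
  have "cmod (- inverse z * \<mu>) \<le> r / cmod z"
    using divide_right_mono[OF \<mu>, of "cmod z"] by (simp add: norm_mult norm_inverse divide_inverse mult.commute)
  then have "Re (- inverse z * \<mu>) \<ge> - (r / cmod z)"
    using abs_Re_le_cmod[of "- inverse z * \<mu>"] by linarith
  then have "norm x * (1 - r / cmod z) \<le> ?N (- inverse z)"
    by (intro order_trans[OF mult_left_mono sub]) auto
  then have "cmod z * (norm x * (1 - r / cmod z)) \<le> norm (z *\<^sub>C (x + (- inverse z) *\<^sub>C A x))"
    unfolding norm_scaleC by (rule mult_left_mono) auto
  also have "z *\<^sub>C (x + (- inverse z) *\<^sub>C A x) = z *\<^sub>C x - A x"
    using z0 by (simp add: scaleC.scale_right_diff_distrib)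
  also have "cmod z * (norm x * (1 - r / cmod z)) = (cmod z - r) * norm x"
    using z0 by (simp add: field_simps)
  finally show ?thesis .
qed simp

text \<open>
  If \<open>y\<close> is in the domain, then \<open>x = R(z) y\<close> satisfies \<open>A x = z x - y\<close>, which is again in the domain, so
  the lower bound for \<open>z - A\<close> applies to \<open>x\<close>. Density and continuity of \<open>R(z)\<close> do the rest.
\<close>

lemma resolvent_bound:
  fixes A :: "'a::complex_normed_vector \<Rightarrow> 'a"
  assumes lin: "linear_operator D A" and dense: "densely_defined D"
    and r: "numerical_spectrum D A \<subseteq> cball 0 r" "r \<ge> 0" and z: "cmod z > r"
  shows "z \<in> resolvent_set D A" "norm (resolvent D A z y) \<le> norm y / (cmod z - r)"
proof -
  show z': "z \<in> resolvent_set D A"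
    using r z by (intro spectrum_subset_numerical_spectrum) auto
  have bound: "norm (resolvent D A z y) \<le> norm y / (cmod z - r)" if y: "y \<in> D" for y
  proof -
    let ?x = "resolvent D A z y"
    have x: "?x \<in> D" by (rule resolvent_in_domain[OF lin z'])
    have "A ?x = z *\<^sub>C ?x - y" using resolvent_right_inverse[OF lin z', of y] by (simp add: algebra_simps)
    then have "A ?x \<in> D"
      using x y subspace_domain[OF lin] by (simp add: scaleC.subspace_diff scaleC.subspace_scale)
    from norm_shifted_operator_lower_bound[OF lin x this r z] show ?thesis
      using z by (simp add: resolvent_right_inverse[OF lin z'] field_simps)
  qed
  have cont: "continuous_on UNIV (resolvent D A z)"
    using bounded_linear_resolvent[OF lin z'] by (intro linear_continuous_on)
  have "closed {y. norm (resolvent D A z y) \<le> norm y / (cmod z - r)}"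
    using z by (intro closed_Collect_le continuous_intros cont) auto
  then have "closure D \<subseteq> {y. norm (resolvent D A z y) \<le> norm y / (cmod z - r)}"
    using bound by (intro closure_minimal) auto
  then show "norm (resolvent D A z y) \<le> norm y / (cmod z - r)"
    using dense by (auto simp: densely_defined_def)
qed

section \<open>Discrete contour means of the resolvent\<close>

text \<open>
  Enlarging a regular \<open>n\<close>-gon will use the factor \<open>q\<close> with \<open>1 / q = 1 + \<i> (1 - cis (- \<eta>))\<close> for
  \<open>\<eta> = 2 \<pi> / n\<close>. To first order \<open>1 / q\<close> is \<open>1 - \<eta>\<close>, so the vertices move outwards on a spiral; the
  bound makes this quantitative, using that \<open>\<bar>1 / q\<bar>\<^sup>2 = 3 - 2 (sin \<eta> + cos \<eta>)\<close>.
\<close>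

lemma spiral_factor_bound:
  assumes "0 \<le> \<eta>" "\<eta> \<le> 1 / 2"
  shows "cmod (1 + \<i> * (1 - cis (- \<eta>))) \<le> exp (- (\<eta> / 2))"
proof -
  have cos: "cos t \<ge> 1 - t\<^sup>2 / 2" for t :: real
  proof -
    have "(sin (t / 2))\<^sup>2 \<le> (t / 2)\<^sup>2"
      using abs_sin_x_le_abs_x[of "t / 2"] by (simp only: abs_le_square_iff)
    then show ?thesis using cos_double_sin[of "t / 2"] by (simp add: power2_eq_square)
  qed
  have "sin \<eta> \<ge> 7 / 8 * \<eta>"
  proof (cases "\<eta> = 0")
    case False
    then obtain t where t: "0 < t" "t < \<eta>" "sin \<eta> - sin 0 = (\<eta> - 0) * cos t"
      using MVT2[of 0 \<eta> sin cos] assms by (auto intro: derivative_eq_intros)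
    have "t\<^sup>2 \<le> (1 / 2)\<^sup>2" using t assms by (intro power_mono) auto
    then have "cos t \<ge> 7 / 8" using cos[of t] by (simp add: power2_eq_square)
    then show ?thesis using t(3) assms mult_left_mono[of "7 / 8" "cos t" \<eta>] by simp
  qed simp
  moreover have "\<eta>\<^sup>2 \<le> \<eta> / 2"
    using mult_left_mono[of \<eta> "1 / 2" \<eta>] assms by (simp add: power2_eq_square)
  moreover have "(cmod (1 + \<i> * (1 - cis (- \<eta>))))\<^sup>2 = 3 - 2 * (sin \<eta> + cos \<eta>)"
  proof -
    have "(cmod (1 + \<i> * (1 - cis (- \<eta>))))\<^sup>2 = (1 - sin \<eta>)\<^sup>2 + (1 - cos \<eta>)\<^sup>2"
      by (simp add: cmod_power2)
    then show ?thesis using sin_cos_squared_add[of \<eta>] by algebra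
  qed
  ultimately have "(cmod (1 + \<i> * (1 - cis (- \<eta>))))\<^sup>2 \<le> 1 - \<eta>"
    using cos[of \<eta>] assms by simp
  also have "\<dots> \<le> exp (- \<eta>)" using exp_ge_add_one_self[of "- \<eta>"] by simp
  also have "\<dots> = (exp (- (\<eta> / 2)))\<^sup>2" by (simp flip: exp_double)
  finally show ?thesis by (rule power2_le_imp_le) simp
qed

lemma spiral_factor_nonzero:
  assumes "\<bar>\<eta>\<bar> \<le> 1 / 2"
  shows "1 + \<i> * (1 - cis (- \<eta>)) \<noteq> 0"
proof
  assume "1 + \<i> * (1 - cis (- \<eta>)) = 0"
  then have "sin \<eta> = 1" by (simp add: complex_eq_iff)
  then show False using abs_sin_x_le_abs_x[of \<eta>] assms by simp
qed

lemma norm_mean_le: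
  fixes f :: "nat \<Rightarrow> 'b::real_normed_vector"
  assumes "\<And>k. norm (f k) \<le> B" "n > 0"
  shows "norm ((1 / n) *\<^sub>R (\<Sum>k<n. f k)) \<le> B"
proof -
  have "norm (\<Sum>k<n. f k) \<le> (\<Sum>k<n. B)"
    by (rule order_trans[OF norm_sum sum_mono]) (rule assms)
  then show ?thesis using assms(2) by (simp add: field_simps)
qed

lemma cis_root_of_unity: "n > 0 \<Longrightarrow> cis (2 * pi / real n) ^ n = 1"
  by (subst Complex.DeMoivre) simp

lemma sum_root_of_unity_powers:
  assumes n: "n \<ge> 2"
  shows "(\<Sum>k<n. cis (2 * pi / real n) ^ k) = 0"
proof -
  have "cis (2 * pi / n) \<noteq> 1"
    using complex_root_unity_eq_1[of n 1] n by (simp add: cis_conv_exp mult_ac)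
  moreover have "cis (2 * pi / n) ^ n = 1" using n by (simp add: cis_root_of_unity)
  ultimately show ?thesis by (simp add: geometric_sum)
qed

context
  fixes D :: "'a::complex_normed_vector set" and A :: "'a \<Rightarrow> 'a" and s M :: real
  assumes lin: "linear_operator D A" and dense: "densely_defined D"
    and s: "s > 0"
    and res: "\<And>z. cmod z \<ge> s \<Longrightarrow> z \<in> resolvent_set D A"
    and bound: "\<And>z y. cmod z \<ge> s \<Longrightarrow> norm (z *\<^sub>C resolvent D A z y) \<le> M * norm y"
begin

definition scaled_resolvent :: "complex \<Rightarrow> 'a \<Rightarrow> 'a" where
  "scaled_resolvent z y = z *\<^sub>C resolvent D A z y"

private abbreviation "G \<equiv> scaled_resolvent"

lemma norm_scaled_resolvent: "cmod z \<ge> s \<Longrightarrow> norm (G z y) \<le> M * norm y"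
  using bound by (simp add: scaled_resolvent_def)

lemma scaled_resolvent_diff: "cmod z \<ge> s \<Longrightarrow> G z (x - y) = G z x - G z y"
  by (simp add: scaled_resolvent_def resolvent_diff[OF lin res] scaleC.scale_right_diff_distrib)

lemma scaled_resolvent_scaleC: "cmod z \<ge> s \<Longrightarrow> G z (c *\<^sub>C y) = c *\<^sub>C G z y"
  by (simp add: scaled_resolvent_def resolvent_scaleC[OF lin res] mult.commute)

lemma bound_nonneg:
  assumes "y \<noteq> (0::'a)" shows "M \<ge> 0"
  using order_trans[OF norm_ge_zero norm_scaled_resolvent[of "complex_of_real s" y]] s assms
  by (simp add: zero_le_mult_iff)

text \<open>
  The resolvent identity in multiplicative form: only the ratio of the two points enters, through
  \<open>b\<close>, which is what makes the remainder estimates uniform in \<open>z\<close>.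
\<close>

lemma scaled_resolvent_step:
  assumes z: "cmod z \<ge> s" "cmod (q * z) \<ge> s" and b: "inverse q = 1 - b" and q: "q \<noteq> 0"
  shows "G (q * z) y - G z y = b *\<^sub>C (G (q * z) y - G z (G (q * z) y))"
proof -
  let ?R = "resolvent D A z" and ?R' = "resolvent D A (q * z)"
  have b': "b * q = q - 1"
    using b q by (simp add: field_simps)
  have "?R' y - ?R y = (z - q * z) *\<^sub>C ?R (?R' y)"
    by (rule resolvent_identity[OF lin res res]) (use z in auto)
  then have R: "?R y = ?R' y - (z - q * z) *\<^sub>C ?R (?R' y)" by (simp add: algebra_simps)
  have "G (q * z) y - G z y = (q * z - z) *\<^sub>C ?R' y + (z * (z - q * z)) *\<^sub>C ?R (?R' y)"
    unfolding scaled_resolvent_def R by (simp add: algebra_simps)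
  also have "\<dots> = (b * (q * z)) *\<^sub>C ?R' y - (b * (z * (q * z))) *\<^sub>C ?R (?R' y)"
  proof -
    have "b * (q * z) = q * z - z" "b * (z * (q * z)) = z * (q * z - z)"
      using b' by algebra+
    then show ?thesis by (simp only:) (simp add: algebra_simps)
  qed
  also have "\<dots> = b *\<^sub>C (G (q * z) y - G z (G (q * z) y))"
    using z by (simp add: scaled_resolvent_def resolvent_scaleC[OF lin res] algebra_simps)
  finally show ?thesis .
qed

text \<open>
  A first order Taylor expansion in \<open>b = 1 - 1 / q\<close>, obtained by inserting the resolvent identity into
  itself. With \<open>G z = z R(z)\<close>, the linear coefficient \<open>(1 - G z) G z\<close> is the same for every
  complex direction of \<open>b\<close>: this is where holomorphy of the resolvent enters.
\<close>

lemma scaled_resolvent_expansion: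
  assumes z: "cmod z \<ge> s" "cmod (q * z) \<ge> s" and b: "inverse q = 1 - b" and q: "q \<noteq> 0"
  shows "norm (G (q * z) y - G z y - b *\<^sub>C (G z y - G z (G z y)))
           \<le> (cmod b)\<^sup>2 * ((1 + M)\<^sup>2 * M * norm y)"
proof -
  define v where "v = G (q * z) y"
  have M: "norm (u - G z u) \<le> (1 + M) * norm u" for u
    using norm_triangle_ineq4[of u "G z u"] norm_scaled_resolvent[OF z(1), of u]
    by (simp add: algebra_simps)
  have step: "v - G z y = b *\<^sub>C (v - G z v)"
    unfolding v_def by (rule scaled_resolvent_step[OF z b q])
  have "v - G z y - b *\<^sub>C (G z y - G z (G z y)) = b *\<^sub>C ((v - G z y) - G z (v - G z y))"
  proof -
    have "b *\<^sub>C (v - G z v) - b *\<^sub>C (G z y - G z (G z y)) = b *\<^sub>C ((v - G z y) - G z (v - G z y))"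
      by (simp add: scaled_resolvent_diff[OF z(1)] algebra_simps)
    then show ?thesis by (simp only: step)
  qed
  also have "G z (v - G z y) = b *\<^sub>C G z (v - G z v)"
    using step z by (simp add: scaled_resolvent_scaleC)
  also have "b *\<^sub>C ((v - G z y) - b *\<^sub>C G z (v - G z v)) = (b * b) *\<^sub>C ((v - G z v) - G z (v - G z v))"
    by (simp only: step scaleC.scale_right_diff_distrib scaleC.scale_scale)
  finally have "norm (v - G z y - b *\<^sub>C (G z y - G z (G z y)))
      = (cmod b)\<^sup>2 * norm ((v - G z v) - G z (v - G z v))"
    by (simp add: norm_scaleC norm_mult power2_eq_square)
  also have "norm ((v - G z v) - G z (v - G z v)) \<le> (1 + M)\<^sup>2 * M * norm y"
  proof (cases "y = 0")
    case True
    then have "v = 0" using norm_scaled_resolvent[OF z(2), of y] by (simp add: v_def)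
    then show ?thesis using True M[of 0] M[of "- G z 0"] by simp
  next
    case False
    then have M0: "M \<ge> 0" by (rule bound_nonneg)
    have "norm ((v - G z v) - G z (v - G z v)) \<le> (1 + M) * ((1 + M) * norm v)"
      using M0 by (intro order_trans[OF M mult_left_mono[OF M]]) auto
    also have "\<dots> \<le> (1 + M) * ((1 + M) * (M * norm y))"
      using M0 z by (intro mult_left_mono) (auto simp: v_def norm_scaled_resolvent)
    finally show ?thesis by (simp add: power2_eq_square mult.assoc)
  qed
  finally show ?thesis by (simp add: v_def mult_left_mono)
qed

definition circle_mean :: "nat \<Rightarrow> complex \<Rightarrow> 'a \<Rightarrow> 'a" where
  "circle_mean n z y = (1 / n) *\<^sub>R (\<Sum>k<n. G (z * cis (2 * pi / n) ^ k) y)"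

text \<open>
  This is the discrete form of Cauchy's theorem. Multiplying a vertex by the root of unity
  \<open>\<zeta> = cis (2 \<pi> / n)\<close> is the step \<open>b = a\<close>, and multiplying it by \<open>q\<close> is the step \<open>b = - \<i> a\<close>. By the
  expansion, the increment of \<open>G\<close> under \<open>q\<close> is \<open>- \<i>\<close> times its increment under \<open>\<zeta>\<close>, up to an error
  of second order. Summed over the polygon, the increments under \<open>\<zeta>\<close> cancel. The factor \<open>q\<close> is chosen
  so that its first order term is exactly \<open>- \<i> a\<close>.
\<close>

lemma circle_mean_step:
  fixes n :: nat
  defines "a \<equiv> 1 - cis (- (2 * pi / n))"
  assumes n: "n > 0" and z: "cmod z \<ge> s" and q: "inverse q = 1 + \<i> * a" "cmod q \<ge> 1"
  shows "norm (circle_mean n (q * z) y - circle_mean n z y)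
           \<le> (2 * pi / n)\<^sup>2 * (2 * ((1 + M)\<^sup>2 * M * norm y))"
proof -
  define \<zeta> where "\<zeta> = cis (2 * pi / n)"
  define K where "K = (1 + M)\<^sup>2 * M * norm y"
  define w where "w k = z * \<zeta> ^ k" for k
  have \<zeta>: "cmod \<zeta> = 1" "\<zeta> ^ n = 1"
    using n by (simp_all add: \<zeta>_def cis_root_of_unity)
  have w: "cmod (w k) \<ge> s" for k
    using z by (simp add: w_def norm_mult norm_power \<zeta>)
  have qw: "cmod (q * w k) \<ge> s" for k
    using order_trans[OF w[of k]] mult_right_mono[OF q(2), of "cmod (w k)"] by (simp add: norm_mult)
  have q0: "q \<noteq> 0" using q(2) by auto
  have K: "K \<ge> 0"
    using bound_nonneg[of y] by (cases "y = 0") (auto simp: K_def)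
  have a: "(cmod a)\<^sup>2 \<le> (2 * pi / n)\<^sup>2"
  proof -
    have "cmod a = 2 * \<bar>sin (- (2 * pi / n) / 2)\<bar>"
      using dist_exp_i_1[of "- (2 * pi / n)"] by (simp add: a_def cis_conv_exp norm_minus_commute)
    also have "\<dots> \<le> 2 * \<bar>- (2 * pi / n) / 2\<bar>"
      by (intro mult_left_mono abs_sin_x_le_abs_x) auto
    finally show ?thesis by (intro power_mono) (auto simp: abs_divide)
  qed
  \<comment> \<open>Second order remainders of the rotation and of the enlargement.\<close>
  define e1 where "e1 k = G (\<zeta> * w k) y - G (w k) y - a *\<^sub>C (G (w k) y - G (w k) (G (w k) y))" for k
  define e2 where "e2 k = G (q * w k) y - G (w k) y - (- \<i> * a) *\<^sub>C (G (w k) y - G (w k) (G (w k) y))" for k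
  have e1: "norm (e1 k) \<le> (cmod a)\<^sup>2 * K" for k
    unfolding e1_def K_def
  proof (rule scaled_resolvent_expansion[OF w])
    show "cmod (\<zeta> * w k) \<ge> s" using w \<zeta> by (simp add: norm_mult)
    show "inverse \<zeta> = 1 - a" "\<zeta> \<noteq> 0" by (simp_all add: a_def \<zeta>_def cis_inverse)
  qed
  have e2: "norm (e2 k) \<le> (cmod a)\<^sup>2 * K" for k
    using scaled_resolvent_expansion[OF w qw, of "- \<i> * a" k y] q q0
    by (auto simp: e2_def K_def norm_mult)
  have "G (q * w k) y - G (w k) y = (- \<i>) *\<^sub>C (G (w (Suc k)) y - G (w k) y) + (\<i> *\<^sub>C e1 k + e2 k)" for k
  proof -
    have "w (Suc k) = \<zeta> * w k" by (simp add: w_def)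
    then show ?thesis by (simp add: e1_def e2_def algebra_simps)
  qed
  then have "(\<Sum>k<n. G (q * w k) y) - (\<Sum>k<n. G (w k) y)
      = (- \<i>) *\<^sub>C (\<Sum>k<n. G (w (Suc k)) y - G (w k) y) + (\<Sum>k<n. \<i> *\<^sub>C e1 k + e2 k)"
    unfolding scaleC.scale_sum_right by (simp only: sum.distrib flip: sum_subtractf)
  also have "(\<Sum>k<n. G (w (Suc k)) y - G (w k) y) = 0"
    by (subst sum_lessThan_telescope) (simp add: w_def \<zeta>)
  finally have "circle_mean n (q * z) y - circle_mean n z y = (1 / n) *\<^sub>R (\<Sum>k<n. \<i> *\<^sub>C e1 k + e2 k)"
    by (simp add: circle_mean_def w_def \<zeta>_def mult.assoc flip: scaleR_diff_right)
  also have "norm \<dots> \<le> (cmod a)\<^sup>2 * (2 * K)"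
  proof (rule norm_mean_le[OF _ n])
    show "norm (\<i> *\<^sub>C e1 k + e2 k) \<le> (cmod a)\<^sup>2 * (2 * K)" for k
      using norm_triangle_ineq[of "\<i> *\<^sub>C e1 k" "e2 k"] e1[of k] e2[of k] by (simp add: norm_scaleC)
  qed
  also have "\<dots> \<le> (2 * pi / n)\<^sup>2 * (2 * K)"
    using a K by (intro mult_right_mono) auto
  finally show ?thesis by (simp add: K_def)
qed

lemma circle_mean_steps:
  fixes n :: nat
  defines "a \<equiv> 1 - cis (- (2 * pi / n))"
  assumes n: "n > 0" and z: "cmod z \<ge> s" and q: "inverse q = 1 + \<i> * a" "cmod q \<ge> 1"
  shows "norm (circle_mean n (q ^ m * z) y - circle_mean n z y)
           \<le> m * ((2 * pi / n)\<^sup>2 * (2 * ((1 + M)\<^sup>2 * M * norm y)))"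
proof (induction m)
  case (Suc m)
  have "cmod (q ^ m * z) \<ge> s"
    using mult_mono[OF one_le_power[OF q(2)] z, of m] s by (simp add: norm_mult norm_power)
  from circle_mean_step[OF n this q[unfolded a_def], of y] Suc show ?case
    using norm_triangle_ineq[of "circle_mean n (q ^ Suc m * z) y - circle_mean n (q ^ m * z) y"
        "circle_mean n (q ^ m * z) y - circle_mean n z y"]
    by (simp add: algebra_simps)
qed simp

text \<open>Each term satisfies \<open>z R(z) x - x = R(z) A x\<close>, which is of order \<open>1 / \<bar>z\<bar>\<close>.\<close>

lemma circle_mean_near_identity:
  assumes n: "n > 0" and z: "cmod z \<ge> s" and x: "x \<in> D"
  shows "norm (circle_mean n z x - x) \<le> M * norm (A x) / cmod z"
proof -
  define w where "w k = z * cis (2 * pi / n) ^ k" for k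
  have w: "cmod (w k) = cmod z" for k by (simp add: w_def norm_mult norm_power)
  have z0: "cmod z > 0" using z s by linarith
  have "norm (G (w k) x - x) \<le> M * norm (A x) / cmod z" for k
  proof -
    have wk: "cmod (w k) \<ge> s" using w z by simp
    have "G (w k) x - x = resolvent D A (w k) (A x)"
      by (simp add: scaled_resolvent_def resolvent_apply_operator[OF lin res[OF wk] x])
    moreover have "cmod z * norm (resolvent D A (w k) (A x)) \<le> M * norm (A x)"
      using bound[OF wk, of "A x"] by (simp add: norm_scaleC w)
    ultimately show ?thesis using z0 by (simp add: field_simps)
  qed
  then have "norm ((1 / n) *\<^sub>R (\<Sum>k<n. G (w k) x - x)) \<le> M * norm (A x) / cmod z"
    by (rule norm_mean_le[OF _ n])
  also have "(1 / n) *\<^sub>R (\<Sum>k<n. G (w k) x - x) = circle_mean n z x - x"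
    using n by (simp add: circle_mean_def w_def sum_subtractf scaleR_diff_right sum_constant_scaleR)
  finally show ?thesis .
qed

text \<open>
  On a large circle the mean is close to \<open>x\<close>, and \<open>n j\<close> spiral steps from the given circle reach
  radius at least \<open>exp (\<pi> j) \<bar>z\<bar>\<close>, changing the mean by \<open>O(j / n)\<close> only. So \<open>j\<close> is fixed first and
  then \<open>n\<close> tends to infinity.
\<close>

lemma circle_mean_tendsto_on_domain:
  assumes z: "cmod z \<ge> s" and x: "x \<in> D"
  shows "(\<lambda>n. circle_mean n z x) \<longlonglongrightarrow> x"
proof (rule LIMSEQ_I)
  fix e :: real assume e: "e > 0"
  define L where "L = M * norm (A x) / cmod z"
  have z0: "cmod z > 0" using z s by linarith
  have L: "L \<ge> 0"
    using bound_nonneg[of "A x"] z0 by (cases "A x = 0") (auto simp: L_def)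
  have "((\<lambda>j. L * exp (- (pi * real j))) \<longlongrightarrow> L * 0) sequentially"
    by (intro tendsto_mult tendsto_const) real_asymp
  then have "eventually (\<lambda>j. L * exp (- (pi * real j)) < e / 2) sequentially"
    using e by (intro order_tendstoD) auto
  then obtain j :: nat where j: "L * exp (- (pi * j)) < e / 2"
    by (auto simp: eventually_sequentially)
  define K where "K = 2 * ((1 + M)\<^sup>2 * M * norm x)"
  have "(\<lambda>n. real (n * j) * ((2 * pi / n)\<^sup>2 * K)) \<longlonglongrightarrow> 0"
    by real_asymp
  then have "eventually (\<lambda>n. real (n * j) * ((2 * pi / n)\<^sup>2 * K) < e / 2) sequentially"
    using e by (intro order_tendstoD) auto
  moreover have "eventually (\<lambda>n. 2 * pi / real n \<le> 1 / 2) sequentially"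
    by real_asymp
  ultimately have "eventually (\<lambda>n. norm (circle_mean n z x - x) < e) sequentially"
    using eventually_gt_at_top[of 0]
  proof eventually_elim
    case (elim n)
    define q where "q = inverse (1 + \<i> * (1 - cis (- (2 * pi / n))))"
    have iq: "inverse q = 1 + \<i> * (1 - cis (- (2 * pi / n)))" by (simp add: q_def)
    have iq_le: "cmod (inverse q) \<le> exp (- (pi / n))"
      using spiral_factor_bound[of "2 * pi / n"] elim by (simp add: iq)
    have "q \<noteq> 0"
      using spiral_factor_nonzero[of "2 * pi / n"] elim by (simp add: q_def)
    then have q: "cmod q \<ge> exp (pi / n)"
      using iq_le by (simp add: norm_inverse exp_minus inverse_le_iff_le)
    moreover have "exp (pi / n) \<ge> 1" by simp
    ultimately have q1: "cmod q \<ge> 1" by linarith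
    define z' where "z' = q ^ (n * j) * z"
    have "exp (pi / n) ^ (n * j) \<le> cmod q ^ (n * j)"
      using q by (intro power_mono) auto
    also have "exp (pi / n) ^ (n * j) = exp (pi * j)"
      using elim by (simp flip: exp_of_nat_mult)
    finally have "exp (pi * j) * cmod z \<le> cmod z'"
      by (simp add: z'_def norm_mult norm_power mult_right_mono)
    moreover have "cmod z \<le> cmod z'"
      using mult_right_mono[OF one_le_power[OF q1], of "cmod z" "n * j"]
      by (simp add: z'_def norm_mult norm_power)
    ultimately have z': "exp (pi * j) * cmod z \<le> cmod z'" "cmod z' \<ge> s" using z by auto
    have "norm (circle_mean n z' x - x) \<le> M * norm (A x) / cmod z'"
      by (rule circle_mean_near_identity) (use elim z' x in auto)
    also have "\<dots> \<le> M * norm (A x) / (exp (pi * j) * cmod z)"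
    proof (rule divide_left_mono[OF z'(1)])
      show "0 \<le> M * norm (A x)" using L z0 by (simp add: L_def zero_le_divide_iff)
      show "0 < cmod z' * (exp (pi * j) * cmod z)"
        using z'(2) z0 s by (intro mult_pos_pos) auto
    qed
    also have "\<dots> = L * exp (- (pi * j))"
      by (simp add: L_def exp_minus field_simps)
    also note j
    finally have far: "norm (circle_mean n z' x - x) < e / 2" .
    have near: "norm (circle_mean n z' x - circle_mean n z x) < e / 2"
      using circle_mean_steps[OF _ z iq q1, of "n * j" x] elim by (simp add: z'_def K_def)
    show ?case
      using norm_triangle_ineq4[of "circle_mean n z' x - x" "circle_mean n z' x - circle_mean n z x"]
        far near by simp
  qed
  then show "\<exists>N. \<forall>n\<ge>N. norm (circle_mean n z x - x) < e"
    by (simp add: eventually_sequentially)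
qed

text \<open>
  The means are bounded by \<open>M\<close> uniformly in \<open>n\<close>, so convergence extends from the dense domain to the
  whole space; the value \<open>A x\<close>, to which this will be applied, need not lie in the domain.
\<close>

lemma circle_mean_tendsto:
  assumes z: "cmod z \<ge> s"
  shows "(\<lambda>n. circle_mean n z y) \<longlonglongrightarrow> y"
proof (cases "\<exists>y::'a. y \<noteq> 0")
  case True
  then have M: "M \<ge> 0" using bound_nonneg by blast
  show ?thesis
  proof (rule LIMSEQ_I)
    fix e :: real assume e: "e > 0"
    define d where "d = e / (2 * (M + 1))"
    have d: "d > 0" using e M by (simp add: d_def)
    then obtain x where x: "x \<in> D" "norm (y - x) < d"
      using dense closure_approachable[of y D] by (auto simp: densely_defined_def dist_norm norm_minus_commute)
    have "eventually (\<lambda>n. norm (circle_mean n z x - x) < e / 2) sequentially"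
      using LIMSEQ_D[OF circle_mean_tendsto_on_domain[OF z x(1)], of "e / 2"] e
      by (auto simp: eventually_sequentially)
    then have "eventually (\<lambda>n. norm (circle_mean n z y - y) < e) sequentially"
      using eventually_gt_at_top[of 0]
    proof eventually_elim
      case (elim n)
      have w: "cmod (z * cis (2 * pi / n) ^ k) \<ge> s" for k
        using z by (simp add: norm_mult norm_power)
      have "circle_mean n z y - circle_mean n z x = circle_mean n z (y - x)"
        by (simp add: circle_mean_def scaled_resolvent_diff[OF w] sum_subtractf scaleR_diff_right)
      also have "norm \<dots> \<le> M * norm (y - x)"
        unfolding circle_mean_def using elim by (intro norm_mean_le norm_scaled_resolvent[OF w])
      finally have "norm (circle_mean n z y - circle_mean n z x) \<le> M * norm (y - x)" .
      moreover have "M * norm (y - x) \<le> M * d"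
        using x M by (intro mult_left_mono) auto
      moreover have "M * d + d = e / 2"
      proof -
        have "M * d + d = (M + 1) * d" by (simp add: algebra_simps)
        also have "\<dots> = e / 2" using M by (simp add: d_def divide_simps)
        finally show ?thesis .
      qed
      moreover have "norm (circle_mean n z y - y)
          \<le> norm (circle_mean n z y - circle_mean n z x) + (norm (circle_mean n z x - x) + norm (y - x))"
        using norm_triangle_ineq[of "circle_mean n z y - circle_mean n z x" "(circle_mean n z x - x) - (y - x)"]
          norm_triangle_ineq4[of "circle_mean n z x - x" "y - x"]
        by simp
      ultimately show ?case
        using elim x by linarith
    qed
    then show "\<exists>N. \<forall>n\<ge>N. norm (circle_mean n z y - y) < e"
      by (simp add: eventually_sequentially)
  qed
next
  case False
  then have zero: "circle_mean n z y = y" for n by metis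
  have "(\<lambda>n. circle_mean n z y) = (\<lambda>n. y)"
    by (rule ext) (rule zero)
  then show ?thesis by (simp only: tendsto_const)
qed

text \<open>
  The means applied to \<open>A x\<close> tend to \<open>A x\<close>. Since \<open>G z (A x) = z G z x - z x\<close> and the vertices sum to
  \<open>0\<close>, the mean of \<open>G z (A x)\<close> is the mean of \<open>z G z x\<close>, whose norm is at most \<open>s M \<parallel>x\<parallel>\<close>. It is the
  discrete counterpart of the first moment \<open>A x = 1/(2\<pi>\<i>) \<integral> z R(z) x dz\<close>.
\<close>

lemma operator_norm_le:
  assumes x: "x \<in> D"
  shows "norm (A x) \<le> s * M * norm x"
proof -
  let ?z = "complex_of_real s"
  have z: "cmod ?z \<ge> s" using s by simp
  have "norm (circle_mean n ?z (A x)) \<le> s * M * norm x" if n: "n \<ge> 2" for n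
  proof -
    define w where "w k = ?z * cis (2 * pi / n) ^ k" for k
    have w: "cmod (w k) = s" for k using s by (simp add: w_def norm_mult norm_power)
    have "(\<Sum>k<n. w k) = 0"
      using sum_root_of_unity_powers[OF n] by (simp add: w_def flip: sum_distrib_left)
    moreover have "G (w k) (A x) = w k *\<^sub>C G (w k) x - w k *\<^sub>C x" for k
      using resolvent_apply_operator[OF lin res x, of "w k"]
      by (simp add: scaled_resolvent_def w scaleC.scale_right_diff_distrib)
    ultimately have "circle_mean n ?z (A x) = (1 / n) *\<^sub>R (\<Sum>k<n. w k *\<^sub>C G (w k) x)"
      by (simp add: circle_mean_def sum_subtractf flip: w_def scaleC.scale_sum_left)
    also have "norm \<dots> \<le> s * M * norm x"
      using n s by (intro norm_mean_le)
        (auto simp: norm_scaleC w mult.assoc intro!: mult_left_mono norm_scaled_resolvent)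
    finally show ?thesis .
  qed
  then show ?thesis
    by (intro LIMSEQ_le_const2[OF tendsto_norm[OF circle_mean_tendsto[OF z]]]) blast
qed

end

text \<open>
  The bound \<open>\<parallel>R(z)\<parallel> \<le> 1 / (\<bar>z\<bar> - r)\<close> gives \<open>\<parallel>z R(z)\<parallel> \<le> \<bar>z\<bar> / (\<bar>z\<bar> - r)\<close>, which decreases in \<open>\<bar>z\<bar>\<close>, so
  \<open>M = s / (s - r)\<close> works on \<open>\<bar>z\<bar> \<ge> s\<close>. The factor \<open>s\<close> outside makes the result vanish as
  \<open>s \<rightarrow> 0\<close> when \<open>r = 0\<close>.
\<close>

lemma operator_norm_le_of_numerical_spectrum:
  fixes A :: "'a::complex_normed_vector \<Rightarrow> 'a"
  assumes lin: "linear_operator D A" and dense: "densely_defined D"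
    and r: "numerical_spectrum D A \<subseteq> cball 0 r" "r \<ge> 0" and s: "s > r" and x: "x \<in> D"
  shows "norm (A x) \<le> s * (s / (s - r)) * norm x"
proof (rule operator_norm_le[OF lin dense _ _ _ x])
  show "s > 0" using r s by simp
  fix z assume z: "cmod z \<ge> s"
  with s have zr: "cmod z > r" by simp
  show "z \<in> resolvent_set D A" by (rule resolvent_bound[OF lin dense r zr])
  fix y
  have "norm (z *\<^sub>C resolvent D A z y) \<le> cmod z * (norm y / (cmod z - r))"
    unfolding norm_scaleC by (rule mult_left_mono[OF resolvent_bound(2)[OF lin dense r zr]]) simp
  also have "\<dots> = cmod z / (cmod z - r) * norm y" by simp
  also have "\<dots> \<le> s / (s - r) * norm y"
  proof (rule mult_right_mono)
    have "cmod z * (s - r) \<le> s * (cmod z - r)"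
      using mult_left_mono[OF z r(2)] by (simp add: algebra_simps)
    then show "cmod z / (cmod z - r) \<le> s / (s - r)"
      using s zr by (simp add: pos_divide_le_eq pos_le_divide_eq)
  qed simp
  finally show "norm (z *\<^sub>C resolvent D A z y) \<le> s / (s - r) * norm y" .
qed

theorem proposition2p10:
  fixes A :: "'a::complex_banach \<Rightarrow> 'a" and D :: "'a set"
  assumes nontrivial: "\<exists>x::'a. x \<noteq> 0"
    and closed: "closed_operator D A"
    and dense: "densely_defined D"
  shows "(bounded_operator D A \<longleftrightarrow> compact (numerical_spectrum D A)) \<and>
         (zero_operator D A \<longleftrightarrow> numerical_spectrum D A = {0})"
proof (intro conjI iffI)
  have lin: "linear_operator D A" using closed by (simp add: closed_operator_def)
  {
    assume bd: "bounded_operator D A"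
    then have D: "D = UNIV" by (rule bounded_operator_domain[OF closed dense])
    obtain C where C: "\<And>x. norm (A x) \<le> C * norm x"
      using bd by (auto simp: bounded_operator_def D)
    have "norm (A x) \<le> \<bar>C\<bar> * norm x" for x
      by (rule order_trans[OF C mult_right_mono]) auto
    then have "numerical_spectrum D A \<subseteq> cball 0 \<bar>C\<bar>"
      unfolding D by (intro numerical_spectrum_bound lin[unfolded D]) auto
    then show "compact (numerical_spectrum D A)"
      by (meson bounded_cball bounded_subset closed_numerical_spectrum compact_eq_bounded_closed)
  next
    assume "compact (numerical_spectrum D A)"
    then obtain r where "numerical_spectrum D A \<subseteq> ball 0 r" "r > 0"
      using bounded_subset_ballD[OF compact_imp_bounded, of "numerical_spectrum D A" 0] by blast
    then have "numerical_spectrum D A \<subseteq> cball 0 r" "r \<ge> 0"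
      by (auto simp: subset_iff intro: less_imp_le)
    then have "norm (A x) \<le> (r + 1) * ((r + 1) / (r + 1 - r)) * norm x" if "x \<in> D" for x
      using that by (intro operator_norm_le_of_numerical_spectrum[OF lin dense]) auto
    then show "bounded_operator D A" unfolding bounded_operator_def by blast
  next
    assume "zero_operator D A"
    then have D: "D = UNIV" and A: "\<And>x. A x = 0" by (auto simp: zero_operator_def)
    have "numerical_spectrum D A \<subseteq> cball 0 0"
      unfolding D by (rule numerical_spectrum_bound) (use lin in \<open>auto simp: D A\<close>)
    moreover have "0 \<notin> resolvent_set D A"
      using nontrivial by (auto simp: resolvent_set_def D A bij_betw_def inj_on_def)
    then have "0 \<in> numerical_spectrum D A"
      using spectrum_subset_numerical_spectrum by blast
    ultimately show "numerical_spectrum D A = {0}" by auto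
  next
    assume "numerical_spectrum D A = {0}"
    then have *: "norm (A x) \<le> s * norm x" if "x \<in> D" "s > 0" for x s
      using operator_norm_le_of_numerical_spectrum[OF lin dense _ _ that(2,1)] that by simp
    have "bounded_operator D A"
      unfolding bounded_operator_def using *[of _ 1] by (intro exI[of _ 1]) auto
    then have D: "D = UNIV" by (rule bounded_operator_domain[OF closed dense])
    have "A x = 0" for x
    proof -
      have "((\<lambda>s. s * norm x) \<longlongrightarrow> 0 * norm x) (at_right 0)"
        by (intro tendsto_intros)
      then have "norm (A x) \<le> 0 * norm x"
        by (rule tendsto_lowerbound) (auto simp: eventually_at_filter * D)
      then show ?thesis by simp
    qed
    then show "zero_operator D A" by (simp add: zero_operator_def D)
  }
qed

end
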